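(* Let $R$ be a ring, $\sigma:R\to R$ a ring endomorphism, and $\delta:R\to R$ a $\sigma$-derivation. Then the Ore extension $R[x;\sigma,\delta]$ satisfies the rank condition if and only if $R$ satisfies the rank condition.
   Context: Rings are associative and unital (not necessarily commutative), and ring homomorphisms preserve unit elements. A $\sigma$-derivation is an additive map $\delta:R\to R$ with $\delta(rs)=\delta(r)s+\sigma(r)\delta(s)$ for all $r,s\in R$. The Ore extension $R[x;\sigma,\delta]$ is the ring of all polynomials in the variable $x$ with coefficients in $R$ written on the left (so it is a free left $R$-module on $\{1,x,x^2,\dots\}$), with multiplication governed by $xr=\sigma(r)x+\delta(r)$ for all $r\in R$. A ring $R$ satisfies the rank condition if, for every positive integer $n$, there is no right $R$-module epimorphism $R^n\to R^{n+1}$ (equivalently, no left $R$-module epimorphism $R^n\to R^{n+1}$). *)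

theory Defs
  imports "HOL-Algebra.UnivPoly"
begin

section \<open>Skew derivations and Ore extensions\<close>

definition sigma_derivation ::
  "('a, 'm) ring_scheme \<Rightarrow> ('a \<Rightarrow> 'a) \<Rightarrow> ('a \<Rightarrow> 'a) \<Rightarrow> bool"
  where "sigma_derivation R \<sigma> \<delta> \<longleftrightarrow>
    \<delta> \<in> carrier R \<rightarrow> carrier R \<and>
    (\<forall>r\<in>carrier R. \<forall>s\<in>carrier R. \<delta> (r \<oplus>\<^bsub>R\<^esub> s) = \<delta> r \<oplus>\<^bsub>R\<^esub> \<delta> s) \<and>
    (\<forall>r\<in>carrier R. \<forall>s\<in>carrier R.
      \<delta> (r \<otimes>\<^bsub>R\<^esub> s) = \<delta> r \<otimes>\<^bsub>R\<^esub> s \<oplus>\<^bsub>R\<^esub> \<sigma> r \<otimes>\<^bsub>R\<^esub> \<delta> s)"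

text \<open>
  Left multiplication by the variable, on coefficient sequences: the rule
  \<open>x r = \<sigma>(r) x + \<delta>(r)\<close> forces
  \<open>x (\<Sum>j. q\<^sub>j x^j) = \<Sum>j. (\<sigma>(q\<^sub>j) x^(j+1) + \<delta>(q\<^sub>j) x^j)\<close>.
\<close>

definition ore_shift ::
  "('a, 'm) ring_scheme \<Rightarrow> ('a \<Rightarrow> 'a) \<Rightarrow> ('a \<Rightarrow> 'a) \<Rightarrow> (nat \<Rightarrow> 'a) \<Rightarrow> nat \<Rightarrow> 'a"
  where "ore_shift R \<sigma> \<delta> q k =
    (case k of 0 \<Rightarrow> \<zero>\<^bsub>R\<^esub> | Suc j \<Rightarrow> \<sigma> (q j)) \<oplus>\<^bsub>R\<^esub> \<delta> (q k)"

text \<open>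
  The Ore extension has the same underlying left \<open>R\<close>-module as the ordinary polynomial
  ring \<^const>\<open>UP\<close> (coefficients on the left); only the product is changed, to
  \<open>(\<Sum>i. p\<^sub>i x^i) q = \<Sum>i. p\<^sub>i (x^i q)\<close>.
  The theorems \<open>ore_extension_ring\<close>, \<open>ore_extension_commutation\<close>, \<open>ore_extension_repr\<close>
  and \<open>ore_extension_coeff_unique\<close> below confirm that this is the ring wanted.
\<close>

definition ore_extension ::
  "('a, 'm) ring_scheme \<Rightarrow> ('a \<Rightarrow> 'a) \<Rightarrow> ('a \<Rightarrow> 'a) \<Rightarrow> ('a, nat \<Rightarrow> 'a) up_ring"
  where "ore_extension R \<sigma> \<delta> = (UP R)
    \<lparr>mult := (\<lambda>p q k. \<Oplus>\<^bsub>R\<^esub>i\<in>{..deg R p}. p i \<otimes>\<^bsub>R\<^esub> (ore_shift R \<sigma> \<delta> ^^ i) q k)\<rparr>"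


section \<open>The rank condition\<close>

definition free_vecs :: "('a, 'm) ring_scheme \<Rightarrow> nat \<Rightarrow> (nat \<Rightarrow> 'a) set"
  where "free_vecs R n = {..<n} \<rightarrow>\<^sub>E carrier R"

definition vec_add ::
  "('a, 'm) ring_scheme \<Rightarrow> nat \<Rightarrow> (nat \<Rightarrow> 'a) \<Rightarrow> (nat \<Rightarrow> 'a) \<Rightarrow> nat \<Rightarrow> 'a"
  where "vec_add R n v w = (\<lambda>i\<in>{..<n}. v i \<oplus>\<^bsub>R\<^esub> w i)"

definition vec_rsmult ::
  "('a, 'm) ring_scheme \<Rightarrow> nat \<Rightarrow> (nat \<Rightarrow> 'a) \<Rightarrow> 'a \<Rightarrow> nat \<Rightarrow> 'a"
  where "vec_rsmult R n v r = (\<lambda>i\<in>{..<n}. v i \<otimes>\<^bsub>R\<^esub> r)"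

definition right_module_hom ::
  "('a, 'm) ring_scheme \<Rightarrow> nat \<Rightarrow> nat \<Rightarrow> ((nat \<Rightarrow> 'a) \<Rightarrow> (nat \<Rightarrow> 'a)) set"
  where "right_module_hom R n m = {f \<in> free_vecs R n \<rightarrow> free_vecs R m.
    (\<forall>v\<in>free_vecs R n. \<forall>w\<in>free_vecs R n.
      f (vec_add R n v w) = vec_add R m (f v) (f w)) \<and>
    (\<forall>v\<in>free_vecs R n. \<forall>r\<in>carrier R.
      f (vec_rsmult R n v r) = vec_rsmult R m (f v) r)}"

definition rank_condition :: "('a, 'm) ring_scheme \<Rightarrow> bool"
  where "rank_condition R \<longleftrightarrow>
    (\<forall>n::nat. n > 0 \<longrightarrow>
      \<not> (\<exists>f \<in> right_module_hom R n (Suc n). f ` free_vecs R n = free_vecs R (Suc n)))"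


section \<open>The Ore extension is a ring with the required properties\<close>

locale ore_data = R?: ring R for R (structure) +
  fixes \<sigma> :: "'a \<Rightarrow> 'a" and \<delta> :: "'a \<Rightarrow> 'a"
  assumes sigma_hom: "\<sigma> \<in> ring_hom R R"
    and delta_der: "sigma_derivation R \<sigma> \<delta>"
begin

abbreviation "T \<equiv> ore_shift R \<sigma> \<delta>"
abbreviation "S \<equiv> ore_extension R \<sigma> \<delta>"

lemma UP_ring_R: "UP_ring R"
  by unfold_locales

lemma sigma_closed [simp]: "a \<in> carrier R \<Longrightarrow> \<sigma> a \<in> carrier R"
  and sigma_add: "\<lbrakk>a \<in> carrier R; b \<in> carrier R\<rbrakk> \<Longrightarrow> \<sigma> (a \<oplus> b) = \<sigma> a \<oplus> \<sigma> b"
  and sigma_mult: "\<lbrakk>a \<in> carrier R; b \<in> carrier R\<rbrakk> \<Longrightarrow> \<sigma> (a \<otimes> b) = \<sigma> a \<otimes> \<sigma> b"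
  and sigma_one [simp]: "\<sigma> \<one> = \<one>"
  using sigma_hom by (auto simp: ring_hom_def)

lemma delta_closed [simp]: "a \<in> carrier R \<Longrightarrow> \<delta> a \<in> carrier R"
  and delta_add: "\<lbrakk>a \<in> carrier R; b \<in> carrier R\<rbrakk> \<Longrightarrow> \<delta> (a \<oplus> b) = \<delta> a \<oplus> \<delta> b"
  and delta_mult:
    "\<lbrakk>a \<in> carrier R; b \<in> carrier R\<rbrakk> \<Longrightarrow> \<delta> (a \<otimes> b) = \<delta> a \<otimes> b \<oplus> \<sigma> a \<otimes> \<delta> b"
  using delta_der by (auto simp: sigma_derivation_def)

lemma sigma_zero [simp]: "\<sigma> \<zero> = \<zero>"
  using sigma_add[of \<zero> \<zero>] by (simp add: R.add.l_cancel_one)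

lemma delta_zero [simp]: "\<delta> \<zero> = \<zero>"
  using delta_add[of \<zero> \<zero>] by (simp add: R.add.l_cancel_one)

lemma delta_one [simp]: "\<delta> \<one> = \<zero>"
  using delta_mult[of \<one> \<one>] by (simp add: R.add.l_cancel_one)

definition Fn :: "(nat \<Rightarrow> 'a) set" where "Fn = UNIV \<rightarrow> carrier R"

lemma FnD [simp]: "f \<in> Fn \<Longrightarrow> f k \<in> carrier R"
  by (auto simp: Fn_def)

lemma FnI: "(\<And>k. f k \<in> carrier R) \<Longrightarrow> f \<in> Fn"
  by (auto simp: Fn_def)

lemma up_Fn: "p \<in> up R \<Longrightarrow> p \<in> Fn"
  by (auto simp: up_def Fn_def)

lemma T_Fn [simp]: "f \<in> Fn \<Longrightarrow> T f \<in> Fn"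
  by (rule FnI) (auto simp: ore_shift_def split: nat.split)

lemma Tpow_Fn [simp]: "f \<in> Fn \<Longrightarrow> (T ^^ i) f \<in> Fn"
  by (induction i) auto

lemma T_up: "f \<in> up R \<Longrightarrow> T f \<in> up R"
proof -
  assume f: "f \<in> up R"
  then obtain n where n: "bound \<zero> n f" by auto
  have "bound \<zero> (Suc n) (T f)"
  proof
    fix m assume "Suc n < m"
    then have "f m = \<zero>" "f (m - 1) = \<zero>" using n by (auto simp: bound_def)
    then show "T f m = \<zero>" using \<open>Suc n < m\<close>
      by (auto simp: ore_shift_def split: nat.split)
  qed
  then show ?thesis
    using FnD[OF T_Fn[OF up_Fn[OF f]]] by blast
qed

lemma Tpow_up: "f \<in> up R \<Longrightarrow> (T ^^ i) f \<in> up R"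
  by (induction i) (auto intro: T_up)

lemma T_zero: "T (\<lambda>_. \<zero>) = (\<lambda>_. \<zero>)"
  by (auto simp: ore_shift_def fun_eq_iff split: nat.split)

lemma T_add:
  "\<lbrakk>f \<in> Fn; g \<in> Fn\<rbrakk> \<Longrightarrow> T (\<lambda>k. f k \<oplus> g k) = (\<lambda>k. T f k \<oplus> T g k)"
  by (auto simp: ore_shift_def fun_eq_iff sigma_add delta_add R.a_ac split: nat.split)

lemma T_smult:
  "\<lbrakk>a \<in> carrier R; f \<in> Fn\<rbrakk> \<Longrightarrow>
    T (\<lambda>k. a \<otimes> f k) = (\<lambda>k. \<sigma> a \<otimes> T f k \<oplus> \<delta> a \<otimes> f k)"
  by (auto simp: ore_shift_def fun_eq_iff sigma_mult delta_mult R.a_ac R.r_distr split: nat.split)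

lemma Tpow_add:
  "\<lbrakk>f \<in> Fn; g \<in> Fn\<rbrakk> \<Longrightarrow> (T ^^ i) (\<lambda>k. f k \<oplus> g k) = (\<lambda>k. (T ^^ i) f k \<oplus> (T ^^ i) g k)"
  by (induction i) (auto simp: T_add)

lemma Tpow_zero: "(T ^^ i) (\<lambda>_. \<zero>) = (\<lambda>_. \<zero>)"
  by (induction i) (auto simp: T_zero)

definition L :: "nat \<Rightarrow> (nat \<Rightarrow> 'a) \<Rightarrow> (nat \<Rightarrow> 'a) \<Rightarrow> nat \<Rightarrow> 'a"
  where "L n p q = (\<lambda>k. \<Oplus>i\<in>{..n}. p i \<otimes> (T ^^ i) q k)"

lemma L_Fn [simp]: "\<lbrakk>p \<in> Fn; q \<in> Fn\<rbrakk> \<Longrightarrow> L n p q \<in> Fn"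
  by (rule FnI) (auto simp: L_def intro!: R.finsum_closed)

lemma L_0: "\<lbrakk>p \<in> Fn; q \<in> Fn\<rbrakk> \<Longrightarrow> L 0 p q = (\<lambda>k. p 0 \<otimes> q k)"
  by (simp add: L_def Pi_def)

lemma L_Suc:
  "\<lbrakk>p \<in> Fn; q \<in> Fn\<rbrakk> \<Longrightarrow> L (Suc n) p q = (\<lambda>k. p (Suc n) \<otimes> (T ^^ Suc n) q k \<oplus> L n p q k)"
  using Tpow_Fn by (simp add: L_def Pi_def del: funpow.simps)

lemma L_extend:
  assumes "p \<in> Fn" "q \<in> Fn" "bound \<zero> m p" "m \<le> n"
  shows "L n p q = L m p q"
  using \<open>m \<le> n\<close>
proof (induction n rule: dec_induct)
  case (step n)
  have "p (Suc n) = \<zero>" using assms step by (auto simp: bound_def)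
  then show ?case using assms step Tpow_Fn[of q "Suc n"]
    by (simp add: L_Suc del: funpow.simps)
qed auto

lemma L_up:
  assumes "p \<in> Fn" "q \<in> up R" shows "L n p q \<in> up R"
proof (induction n)
  case 0
  then show ?case using assms by (simp add: L_0 up_Fn R.up_smult_closed)
next
  case (Suc n)
  then show ?case using assms
    by (simp add: L_Suc up_Fn R.up_smult_closed R.up_add_closed Tpow_up del: funpow.simps)
qed

lemma bound_deg: "p \<in> up R \<Longrightarrow> bound \<zero> (deg R p) p"
  using UP_ring.deg_aboveD[OF UP_ring_R, of p] by (auto simp: UP_def bound_def)

lemma carrier_ore [simp]: "carrier S = up R"
  and zero_ore: "\<zero>\<^bsub>S\<^esub> = (\<lambda>_. \<zero>)"
  and one_ore: "\<one>\<^bsub>S\<^esub> = (\<lambda>i. if i = 0 then \<one> else \<zero>)"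
  and add_ore: "\<lbrakk>p \<in> up R; q \<in> up R\<rbrakk> \<Longrightarrow> p \<oplus>\<^bsub>S\<^esub> q = (\<lambda>k. p k \<oplus> q k)"
  and smult_ore: "\<lbrakk>a \<in> carrier R; p \<in> up R\<rbrakk> \<Longrightarrow> a \<odot>\<^bsub>S\<^esub> p = (\<lambda>k. a \<otimes> p k)"
  and monom_ore: "a \<in> carrier R \<Longrightarrow> monom S a n = (\<lambda>i. if i = n then a else \<zero>)"
  and mult_ore_deg: "p \<otimes>\<^bsub>S\<^esub> q = L (deg R p) p q"
  by (auto simp: ore_extension_def UP_def L_def)

lemma mult_ore:
  assumes "p \<in> up R" "q \<in> Fn" "bound \<zero> n p"
  shows "p \<otimes>\<^bsub>S\<^esub> q = L n p q"
proof -
  have "L (max n (deg R p)) p q = L n p q" "L (max n (deg R p)) p q = L (deg R p) p q"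
    using assms bound_deg[of p] up_Fn by (intro L_extend; simp)+
  then show ?thesis by (simp add: mult_ore_deg)
qed

lemma mult_closed: "\<lbrakk>p \<in> up R; q \<in> up R\<rbrakk> \<Longrightarrow> p \<otimes>\<^bsub>S\<^esub> q \<in> up R"
  by (simp add: mult_ore_deg L_up up_Fn)

lemma L_add_left:
  assumes "p \<in> Fn" "p' \<in> Fn" "q \<in> Fn"
  shows "L n (\<lambda>k. p k \<oplus> p' k) q = (\<lambda>k. L n p q k \<oplus> L n p' q k)"
  using assms by (auto simp: L_def fun_eq_iff R.l_distr R.finsum_addf Pi_def)

lemma L_add_right:
  assumes "p \<in> Fn" "q \<in> Fn" "q' \<in> Fn"
  shows "L n p (\<lambda>k. q k \<oplus> q' k) = (\<lambda>k. L n p q k \<oplus> L n p q' k)"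
  using assms by (auto simp: L_def fun_eq_iff R.r_distr R.finsum_addf Pi_def Tpow_add)

lemma L_smult_left:
  assumes "a \<in> carrier R" "p \<in> Fn" "q \<in> Fn"
  shows "L n (\<lambda>k. a \<otimes> p k) q = (\<lambda>k. a \<otimes> L n p q k)"
  using assms by (auto simp: L_def fun_eq_iff R.m_assoc R.finsum_rdistr Pi_def)

lemma common_bound:
  assumes "p \<in> up R" "q \<in> up R"
  obtains n where "bound \<zero> n p" "bound \<zero> n q"
proof -
  obtain m m' where "bound \<zero> m p" "bound \<zero> m' q" using assms by fast
  then have "bound \<zero> (max m m') p" "bound \<zero> (max m m') q" by (auto simp: bound_def)
  then show ?thesis by (rule that)
qed

lemma mult_add_left:
  assumes "p \<in> up R" "p' \<in> up R" "q \<in> Fn"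
  shows "(\<lambda>k. p k \<oplus> p' k) \<otimes>\<^bsub>S\<^esub> q = (\<lambda>k. (p \<otimes>\<^bsub>S\<^esub> q) k \<oplus> (p' \<otimes>\<^bsub>S\<^esub> q) k)"
proof -
  obtain n where n: "bound \<zero> n p" "bound \<zero> n p'" using assms common_bound by blast
  then have "bound \<zero> n (\<lambda>k. p k \<oplus> p' k)" by (auto simp: bound_def)
  then show ?thesis
    using assms n by (simp add: mult_ore R.up_add_closed L_add_left up_Fn)
qed

lemma mult_smult_left:
  assumes "a \<in> carrier R" "p \<in> up R" "q \<in> Fn"
  shows "(\<lambda>k. a \<otimes> p k) \<otimes>\<^bsub>S\<^esub> q = (\<lambda>k. a \<otimes> (p \<otimes>\<^bsub>S\<^esub> q) k)"
proof -
  obtain n where n: "bound \<zero> n p" using assms by fast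
  then have "bound \<zero> n (\<lambda>k. a \<otimes> p k)" using assms by (auto simp: bound_def)
  then show ?thesis
    using assms n by (simp add: mult_ore R.up_smult_closed L_smult_left up_Fn)
qed

lemma T_L:
  assumes "p \<in> Fn" "q \<in> Fn"
  shows "T (L n p q) = (\<lambda>k. L n (\<lambda>i. \<sigma> (p i)) (T q) k \<oplus> L n (\<lambda>i. \<delta> (p i)) q k)"
proof (induction n)
  case 0
  have "(\<lambda>i. \<sigma> (p i)) \<in> Fn" "(\<lambda>i. \<delta> (p i)) \<in> Fn" using assms by (auto intro: FnI)
  then show ?case using assms by (simp add: L_0 T_smult)
next
  case (Suc n)
  have Fn: "(\<lambda>i. \<sigma> (p i)) \<in> Fn" "(\<lambda>i. \<delta> (p i)) \<in> Fn" "(T ^^ Suc n) q \<in> Fn"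
      "(T ^^ Suc n) (T q) \<in> Fn"
    using assms by (auto intro!: FnI simp del: funpow.simps)
  have 1: "T ((T ^^ Suc n) q) = (T ^^ Suc n) (T q)" by (simp add: funpow_swap1)
  have "T (L (Suc n) p q) = T (\<lambda>k. p (Suc n) \<otimes> (T ^^ Suc n) q k \<oplus> L n p q k)"
    using assms by (simp add: L_Suc del: funpow.simps)
  also have "\<dots> = (\<lambda>k. T (\<lambda>k. p (Suc n) \<otimes> (T ^^ Suc n) q k) k \<oplus> T (L n p q) k)"
    using assms Fn by (intro T_add) (auto intro!: FnI simp del: funpow.simps)
  also have "T (\<lambda>k. p (Suc n) \<otimes> (T ^^ Suc n) q k) =
      (\<lambda>k. \<sigma> (p (Suc n)) \<otimes> (T ^^ Suc n) (T q) k \<oplus> \<delta> (p (Suc n)) \<otimes> (T ^^ Suc n) q k)"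
    using assms Fn by (simp add: T_smult 1 del: funpow.simps)
  finally show ?case
    using assms Fn by (simp add: Suc.IH L_Suc R.a_ac del: funpow.simps)
qed

lemma L_shift:
  assumes "p \<in> Fn" "q \<in> Fn"
  shows "L (Suc n) (\<lambda>k. case k of 0 \<Rightarrow> \<zero> | Suc j \<Rightarrow> p j) q = L n p (T q)"
proof (induction n)
  let ?p = "\<lambda>k. case k of 0 \<Rightarrow> \<zero> | Suc j \<Rightarrow> p j"
  have p: "?p \<in> Fn" using assms by (auto intro!: FnI split: nat.split)
  case 0
  then show ?case using assms p by (simp add: L_Suc L_0)
next
  let ?p = "\<lambda>k. case k of 0 \<Rightarrow> \<zero> | Suc j \<Rightarrow> p j"
  have p: "?p \<in> Fn" using assms by (auto intro!: FnI split: nat.split)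
  case (Suc n)
  have "(T ^^ Suc (Suc n)) q = (T ^^ Suc n) (T q)" by (simp only: funpow_Suc_right o_apply)
  then show ?case using assms p Suc by (simp add: L_Suc del: funpow.simps)
qed

lemma mult_T_left:
  assumes "p \<in> up R" "q \<in> Fn"
  shows "T p \<otimes>\<^bsub>S\<^esub> q = T (p \<otimes>\<^bsub>S\<^esub> q)"
proof -
  have p: "p \<in> Fn" using assms up_Fn by auto
  obtain n where n: "bound \<zero> n p" "bound \<zero> n (T p)"
    using assms common_bound T_up by blast
  have F: "(\<lambda>i. \<sigma> (p i)) \<in> Fn" "(\<lambda>i. \<delta> (p i)) \<in> Fn"
      "(\<lambda>k. case k of 0 \<Rightarrow> \<zero> | Suc j \<Rightarrow> \<sigma> (p j)) \<in> Fn"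
    using p by (auto intro!: FnI split: nat.split)
  have b: "bound \<zero> n (\<lambda>i. \<delta> (p i))" using n by (auto simp: bound_def)
  have "bound \<zero> (Suc n) (T p)" using n by (auto simp: bound_def)
  then have "T p \<otimes>\<^bsub>S\<^esub> q = L (Suc n) (T p) q"
    using assms T_up mult_ore by blast
  also have "L (Suc n) (T p) q =
      L (Suc n) (\<lambda>k. (case k of 0 \<Rightarrow> \<zero> | Suc j \<Rightarrow> \<sigma> (p j)) \<oplus> \<delta> (p k)) q"
    by (rule arg_cong[where f = "\<lambda>h. L (Suc n) h q"]) (auto simp: ore_shift_def)
  also have "\<dots> =
      (\<lambda>k. L (Suc n) (\<lambda>k. case k of 0 \<Rightarrow> \<zero> | Suc j \<Rightarrow> \<sigma> (p j)) q k \<oplus>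
        L (Suc n) (\<lambda>i. \<delta> (p i)) q k)"
    using F assms by (intro L_add_left) auto
  also have "\<dots> = T (L n p q)"
    using F assms p b by (simp add: L_shift T_L L_extend[of _ _ n "Suc n"])
  finally show ?thesis using assms n by (simp add: mult_ore)
qed

lemma mult_Tpow_left:
  assumes "p \<in> up R" "q \<in> Fn"
  shows "(T ^^ i) p \<otimes>\<^bsub>S\<^esub> q = (T ^^ i) (p \<otimes>\<^bsub>S\<^esub> q)"
proof (induction i)
  case 0
  show ?case by simp
next
  case (Suc i)
  have "(T ^^ i) p \<in> up R" using assms(1) by (rule Tpow_up)
  then show ?case using mult_T_left assms(2) Suc.IH by simp
qed

lemma mult_L_assoc:
  assumes "p \<in> Fn" "q \<in> up R" "r \<in> up R"
  shows "L n p q \<otimes>\<^bsub>S\<^esub> r = L n p (q \<otimes>\<^bsub>S\<^esub> r)"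
proof (induction n)
  case 0
  have F: "q \<in> Fn" "r \<in> Fn" "q \<otimes>\<^bsub>S\<^esub> r \<in> Fn" using assms by (simp_all add: up_Fn mult_closed)
  show ?case unfolding L_0[OF assms(1) F(1)] L_0[OF assms(1) F(3)]
    by (rule mult_smult_left[OF FnD[OF assms(1)] assms(2) F(2)])
next
  case (Suc n)
  have qr: "q \<otimes>\<^bsub>S\<^esub> r \<in> Fn" using assms by (simp add: up_Fn mult_closed)
  have "L (Suc n) p q \<otimes>\<^bsub>S\<^esub> r =
      (\<lambda>k. p (Suc n) \<otimes> (T ^^ Suc n) q k \<oplus> L n p q k) \<otimes>\<^bsub>S\<^esub> r"
    using assms by (simp add: L_Suc up_Fn del: funpow.simps)
  also have "\<dots> = (\<lambda>k. ((\<lambda>k. p (Suc n) \<otimes> (T ^^ Suc n) q k) \<otimes>\<^bsub>S\<^esub> r) k \<oplus>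
      (L n p q \<otimes>\<^bsub>S\<^esub> r) k)"
    using assms
    by (intro mult_add_left) (auto intro!: R.up_smult_closed Tpow_up L_up up_Fn simp del: funpow.simps)
  also have "\<dots> = L (Suc n) p (q \<otimes>\<^bsub>S\<^esub> r)"
    using assms qr
    by (simp add: mult_smult_left Tpow_up up_Fn mult_Tpow_left L_Suc Suc.IH del: funpow.simps)
  finally show ?case .
qed

theorem ore_extension_ring: "ring S"
proof -
  have S: "carrier S = carrier (UP R)" "add S = add (UP R)" "zero S = zero (UP R)"
      "one S = one (UP R)"
    by (simp_all add: ore_extension_def)
  show ?thesis
  proof (rule ringI)
    show "abelian_group S"
      using ring.is_abelian_group[OF UP_ring.UP_ring[OF UP_ring_R]]
      by (simp only: abelian_group_def abelian_monoid_def abelian_group_axioms_def S)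
  next
    show "monoid S"
    proof (rule monoidI)
      fix p q r assume A: "p \<in> carrier S" "q \<in> carrier S" "r \<in> carrier S"
      then show "p \<otimes>\<^bsub>S\<^esub> q \<otimes>\<^bsub>S\<^esub> r = p \<otimes>\<^bsub>S\<^esub> (q \<otimes>\<^bsub>S\<^esub> r)"
        unfolding mult_ore_deg[of p] using mult_L_assoc[of p q r "deg R p"] by (auto simp: up_Fn)
    next
      fix p assume A: "p \<in> carrier S"
      have one: "\<one>\<^bsub>S\<^esub> \<in> up R" "bound \<zero> 0 \<one>\<^bsub>S\<^esub>"
        by (auto simp: one_ore R.up_one_closed bound_def)
      have pF: "p \<in> Fn" and oneF: "\<one>\<^bsub>S\<^esub> \<in> Fn" using A one up_Fn by auto
      have "\<one>\<^bsub>S\<^esub> \<otimes>\<^bsub>S\<^esub> p = L 0 \<one>\<^bsub>S\<^esub> p" by (rule mult_ore[OF one(1) pF one(2)])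
      also have "\<dots> = p" unfolding L_0[OF oneF pF] using pF by (simp add: one_ore)
      finally show "\<one>\<^bsub>S\<^esub> \<otimes>\<^bsub>S\<^esub> p = p" .
      have Ti: "(T ^^ i) \<one>\<^bsub>S\<^esub> = (\<lambda>k. if k = i then \<one> else \<zero>)" for i
      proof (induction i)
        case 0
        show ?case by (simp add: one_ore)
      next
        case (Suc i)
        have "T (\<lambda>k. if k = i then \<one> else \<zero>) = (\<lambda>k. if k = Suc i then \<one> else \<zero>)"
          by (auto simp: ore_shift_def fun_eq_iff split: nat.split)
        then show ?case using Suc.IH by simp
      qed
      have "L n p \<one>\<^bsub>S\<^esub> = (\<lambda>k. if k \<le> n then p k else \<zero>)" for n
      proof (induction n)
        case 0
        show ?case unfolding L_0[OF pF oneF] using pF by (auto simp: one_ore fun_eq_iff)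
      next
        case (Suc n)
        show ?case unfolding L_Suc[OF pF oneF] Ti Suc.IH
          using pF by (auto simp: fun_eq_iff le_Suc_eq)
      qed
      then have "p \<otimes>\<^bsub>S\<^esub> \<one>\<^bsub>S\<^esub> = (\<lambda>k. if k \<le> deg R p then p k else \<zero>)"
        by (simp add: mult_ore_deg)
      then show "p \<otimes>\<^bsub>S\<^esub> \<one>\<^bsub>S\<^esub> = p"
        using bound_deg[of p] A by (auto simp: bound_def fun_eq_iff)
    qed (auto simp: mult_closed, simp add: one_ore R.up_one_closed)
  next
    fix p q r assume A: "p \<in> carrier S" "q \<in> carrier S" "r \<in> carrier S"
    then show "(p \<oplus>\<^bsub>S\<^esub> q) \<otimes>\<^bsub>S\<^esub> r = p \<otimes>\<^bsub>S\<^esub> r \<oplus>\<^bsub>S\<^esub> q \<otimes>\<^bsub>S\<^esub> r"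
      by (simp add: add_ore mult_closed mult_add_left up_Fn)
    show "r \<otimes>\<^bsub>S\<^esub> (p \<oplus>\<^bsub>S\<^esub> q) = r \<otimes>\<^bsub>S\<^esub> p \<oplus>\<^bsub>S\<^esub> r \<otimes>\<^bsub>S\<^esub> q"
      using A mult_closed by (simp add: add_ore, simp add: mult_ore_deg L_add_right up_Fn)
  qed
qed

lemma monom_up: "a \<in> carrier R \<Longrightarrow> monom S a n \<in> up R"
  using UP_ring.monom_closed[OF UP_ring_R, of a n] by (simp add: ore_extension_def UP_def)

lemma const_mult:
  assumes "a \<in> carrier R" "p \<in> up R"
  shows "monom S a 0 \<otimes>\<^bsub>S\<^esub> p = a \<odot>\<^bsub>S\<^esub> p"
proof -
  have "bound \<zero> 0 (monom S a 0)" using assms by (auto simp: monom_ore bound_def)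
  then show ?thesis using assms mult_ore[of "monom S a 0" p 0] monom_up[of a 0]
    by (simp add: L_0 up_Fn smult_ore monom_ore)
qed

lemma var_mult:
  assumes "p \<in> up R"
  shows "monom S \<one> (Suc 0) \<otimes>\<^bsub>S\<^esub> p = T p"
proof -
  have "bound \<zero> (Suc 0) (monom S \<one> (Suc 0))" by (auto simp: monom_ore bound_def)
  then show ?thesis using assms mult_ore[of "monom S \<one> (Suc 0)" p "Suc 0"] monom_up[of \<one> "Suc 0"]
    by (simp add: L_0 L_Suc up_Fn monom_ore)
qed

theorem ore_extension_const_hom: "(\<lambda>a. monom S a 0) \<in> ring_hom R S"
proof (rule ring_hom_memI)
  fix a b assume A: "a \<in> carrier R" "b \<in> carrier R"
  show "monom S a 0 \<in> carrier S" using A monom_up by simp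
  show "monom S (a \<otimes> b) 0 = monom S a 0 \<otimes>\<^bsub>S\<^esub> monom S b 0"
    using A by (subst const_mult) (auto simp: monom_up smult_ore, auto simp: monom_ore)
  show "monom S (a \<oplus> b) 0 = monom S a 0 \<oplus>\<^bsub>S\<^esub> monom S b 0"
    using A by (subst add_ore) (auto simp: monom_up, auto simp: monom_ore)
qed (auto simp: one_ore monom_ore)

theorem ore_extension_commutation:
  assumes "r \<in> carrier R"
  shows "monom S \<one> (Suc 0) \<otimes>\<^bsub>S\<^esub> monom S r 0 =
    monom S (\<sigma> r) 0 \<otimes>\<^bsub>S\<^esub> monom S \<one> (Suc 0) \<oplus>\<^bsub>S\<^esub> monom S (\<delta> r) 0"
proof -
  have up: "(\<lambda>k. \<sigma> r \<otimes> monom S \<one> (Suc 0) k) \<in> up R"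
    using assms by (intro R.up_smult_closed) (auto simp: monom_up)
  have "T (monom S r 0) = (\<lambda>k. \<sigma> r \<otimes> monom S \<one> (Suc 0) k \<oplus> monom S (\<delta> r) 0 k)"
    using assms by (auto simp: monom_ore ore_shift_def fun_eq_iff split: nat.split)
  also have "\<dots> = (\<lambda>k. \<sigma> r \<otimes> monom S \<one> (Suc 0) k) \<oplus>\<^bsub>S\<^esub> monom S (\<delta> r) 0"
    using assms up by (simp add: add_ore monom_up)
  finally show ?thesis
    using assms by (simp add: var_mult const_mult monom_up smult_ore)
qed

lemma var_pow: "monom S \<one> (Suc 0) [^]\<^bsub>S\<^esub> n = monom S \<one> n"
proof (induction n)
  case 0
  then show ?case by (auto simp: monom_ore one_ore)
next
  case (Suc n)
  interpret S: ring S by (rule ore_extension_ring)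
  have "monom S \<one> (Suc 0) [^]\<^bsub>S\<^esub> Suc n = monom S \<one> (Suc 0) \<otimes>\<^bsub>S\<^esub> monom S \<one> n"
    using monom_up[of \<one> "Suc 0"] by (subst S.nat_pow_Suc2) (auto simp: Suc)
  also have "\<dots> = monom S \<one> (Suc n)"
    using monom_up by (auto simp: var_mult)
      (auto simp: monom_ore ore_shift_def fun_eq_iff split: nat.split)
  finally show ?case .
qed

theorem ore_extension_repr:
  assumes "p \<in> carrier S"
  shows "p = (\<Oplus>\<^bsub>S\<^esub>i\<in>{..deg R p}. monom S (p i) 0 \<otimes>\<^bsub>S\<^esub> monom S \<one> (Suc 0) [^]\<^bsub>S\<^esub> i)"
proof -
  interpret S: ring S by (rule ore_extension_ring)
  have p: "p \<in> carrier (UP R)" "\<And>i. p i \<in> carrier R" using assms by (auto simp: UP_def)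
  have eq: "monom S (p i) 0 \<otimes>\<^bsub>S\<^esub> monom S \<one> (Suc 0) [^]\<^bsub>S\<^esub> i = monom S (p i) i" for i
    using p by (subst var_pow, subst const_mult)
      (auto simp: monom_up smult_ore, auto simp: monom_ore)
  have sum: "finsum S f A = finsum (UP R) f A" for f :: "nat \<Rightarrow> nat \<Rightarrow> 'a" and A
    by (simp add: ore_extension_def finsum_def finprod_def)
  have coe: "coeff (UP R) p = p" using p by (auto simp: UP_def)
  have "p = (\<Oplus>\<^bsub>UP R\<^esub>i\<in>{..deg R p}. monom (UP R) (coeff (UP R) p i) i)"
    using UP_ring.up_repr[OF UP_ring_R p(1)] by simp
  also have "\<dots> = (\<Oplus>\<^bsub>S\<^esub>i\<in>{..deg R p}. monom S (p i) i)"
    unfolding sum coe by (simp add: ore_extension_def)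
  finally show ?thesis by (simp add: eq)
qed

theorem ore_extension_coeff_unique:
  assumes "\<And>i. i \<le> n \<Longrightarrow> a i \<in> carrier R" "k \<le> n"
  shows "(\<Oplus>\<^bsub>S\<^esub>i\<in>{..n}. monom S (a i) 0 \<otimes>\<^bsub>S\<^esub> monom S \<one> (Suc 0) [^]\<^bsub>S\<^esub> i) k = a k"
proof -
  interpret S: ring S by (rule ore_extension_ring)
  have eq: "monom S (a i) 0 \<otimes>\<^bsub>S\<^esub> monom S \<one> (Suc 0) [^]\<^bsub>S\<^esub> i = monom S (a i) i" if "i \<le> n" for i
    using assms(1)[OF that] by (subst var_pow, subst const_mult)
      (auto simp: monom_up smult_ore, auto simp: monom_ore)
  have *: "(\<Oplus>\<^bsub>S\<^esub>i\<in>{..m}. monom S (a i) i) = (\<lambda>k. if k \<le> m then a k else \<zero>) \<and>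
      (\<Oplus>\<^bsub>S\<^esub>i\<in>{..m}. monom S (a i) i) \<in> up R" if "m \<le> n" for m
    using that
  proof (induction m)
    case 0
    then show ?case using assms(1)[of 0] by (simp add: monom_up, simp add: monom_ore fun_eq_iff)
  next
    case (Suc m)
    have in_up: "monom S (a i) i \<in> up R" if "i \<le> Suc m" for i
      using assms(1)[of i] that Suc.prems by (intro monom_up) auto
    have "(\<Oplus>\<^bsub>S\<^esub>i\<in>{..Suc m}. monom S (a i) i) =
        monom S (a (Suc m)) (Suc m) \<oplus>\<^bsub>S\<^esub> (\<Oplus>\<^bsub>S\<^esub>i\<in>{..m}. monom S (a i) i)"
      using in_up by (subst atMost_Suc, subst S.finsum_insert) auto
    moreover have "\<dots> \<in> up R"
      using Suc in_up[of "Suc m"] S.a_closed by auto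
    moreover have "monom S (a (Suc m)) (Suc m) \<oplus>\<^bsub>S\<^esub> (\<Oplus>\<^bsub>S\<^esub>i\<in>{..m}. monom S (a i) i) =
        (\<lambda>k. monom S (a (Suc m)) (Suc m) k \<oplus> (if k \<le> m then a k else \<zero>))"
      using Suc in_up[of "Suc m"] by (subst add_ore) auto
    moreover have "\<dots> = (\<lambda>k. if k \<le> Suc m then a k else \<zero>)"
      using Suc.prems assms(1) by (auto simp: fun_eq_iff monom_ore le_Suc_eq)
    ultimately show ?case by simp
  qed
  have "(\<Oplus>\<^bsub>S\<^esub>i\<in>{..n}. monom S (a i) 0 \<otimes>\<^bsub>S\<^esub> monom S \<one> (Suc 0) [^]\<^bsub>S\<^esub> i) =
      (\<Oplus>\<^bsub>S\<^esub>i\<in>{..n}. monom S (a i) i)"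
    using assms(1) eq by (intro S.finsum_cong') (auto simp: monom_up)
  then show ?thesis using *[of n] assms(2) by simp
qed

end

end

theory Submission
  imports Defs
begin

text \<open>
  A ring fails the rank condition iff some identity matrix factors through a smaller one.
  Such factorisations are carried along ring homomorphisms, in particular from \<open>R\<close> to its Ore
  extension \<open>S\<close>.
  Conversely let \<open>A B = 1\<close> over \<open>S\<close> with \<open>A\<close> of size \<open>(n+1) \<times> n\<close> and entries of degree at most
  \<open>k\<close>. The left \<open>R\<close>-linear map \<open>v \<mapsto> v A\<close> sends row vectors of degree at most \<open>d\<close> to row vectors of
  degree at most \<open>d + k\<close>, and \<open>v \<mapsto> v B\<close> followed by truncation to degree at most \<open>d\<close> undoes it.
  Hence the identity of rank \<open>(n+1)(d+1)\<close> over \<open>R\<close> factors through rank \<open>n(d+k+1)\<close>, which is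
  smaller for \<open>d = n k\<close>.
\<close>

section \<open>Double products over finite index sets\<close>

context comm_monoid
begin

text \<open>Stated for a commutative monoid so that the additive monoid of a ring yields the
  corresponding fact about double sums, through the prefix \<open>add\<close>.\<close>

lemma finprod_cartesian_product:
  assumes "finite A" "finite B" "\<And>x y. x \<in> A \<Longrightarrow> y \<in> B \<Longrightarrow> f (x, y) \<in> carrier G"
  shows "(\<Otimes>z\<in>A \<times> B. f z) = (\<Otimes>x\<in>A. \<Otimes>y\<in>B. f (x, y))"
  using assms(1,3)
proof (induction A)
  case empty
  then show ?case by simp
next
  case (insert x A)
  have "(\<Otimes>z\<in>insert x A \<times> B. f z) = (\<Otimes>z\<in>Pair x ` B \<union> A \<times> B. f z)"
    by (rule arg_cong[where f = "finprod G f"]) auto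
  also have "\<dots> = (\<Otimes>z\<in>Pair x ` B. f z) \<otimes> (\<Otimes>z\<in>A \<times> B. f z)"
    using insert assms(2) by (intro finprod_Un_disjoint) auto
  also have "(\<Otimes>z\<in>Pair x ` B. f z) = (\<Otimes>y\<in>B. f (x, y))"
    using insert.prems by (intro finprod_reindex) (auto simp: inj_on_def)
  also have "(\<Otimes>z\<in>A \<times> B. f z) = (\<Otimes>x\<in>A. \<Otimes>y\<in>B. f (x, y))"
    using insert by simp
  finally show ?case
    using insert by (simp add: Pi_def)
qed

lemma finprod_swap:
  assumes "finite A" "finite B" "\<And>x y. x \<in> A \<Longrightarrow> y \<in> B \<Longrightarrow> f x y \<in> carrier G"
  shows "(\<Otimes>x\<in>A. \<Otimes>y\<in>B. f x y) = (\<Otimes>y\<in>B. \<Otimes>x\<in>A. f x y)"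
  using assms(1,3)
proof (induction A)
  case (insert x A)
  have "(\<Otimes>y\<in>B. \<Otimes>x\<in>insert x A. f x y) = (\<Otimes>y\<in>B. f x y \<otimes> (\<Otimes>x\<in>A. f x y))"
    using insert by (intro finprod_cong') auto
  also have "\<dots> = (\<Otimes>y\<in>B. f x y) \<otimes> (\<Otimes>y\<in>B. \<Otimes>x\<in>A. f x y)"
    using insert by (intro finprod_multf) auto
  finally show ?case
    using insert by (simp add: Pi_def)
qed simp

end

section \<open>Factorisations of identity matrices\<close>

text \<open>The index sets are arbitrary so that a pair (position, degree) can serve as an index
  without being numbered.\<close>

definition identity_factors :: "('a, 'm) ring_scheme \<Rightarrow> 'i set \<Rightarrow> 'j set \<Rightarrow> bool"
  where "identity_factors R I J \<longleftrightarrow> (\<exists>A B.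
    (\<forall>i\<in>I. \<forall>j\<in>J. A i j \<in> carrier R \<and> B j i \<in> carrier R) \<and>
    (\<forall>i\<in>I. \<forall>k\<in>I.
      (\<Oplus>\<^bsub>R\<^esub>j\<in>J. A i j \<otimes>\<^bsub>R\<^esub> B j k) = (if i = k then \<one>\<^bsub>R\<^esub> else \<zero>\<^bsub>R\<^esub>)))"

lemma identity_factorsE:
  assumes "identity_factors R I J"
  obtains A B where "\<And>i j. i \<in> I \<Longrightarrow> j \<in> J \<Longrightarrow> A i j \<in> carrier R"
    and "\<And>i j. i \<in> I \<Longrightarrow> j \<in> J \<Longrightarrow> B j i \<in> carrier R"
    and "\<And>i k. i \<in> I \<Longrightarrow> k \<in> I \<Longrightarrow>
      (\<Oplus>\<^bsub>R\<^esub>j\<in>J. A i j \<otimes>\<^bsub>R\<^esub> B j k) = (if i = k then \<one>\<^bsub>R\<^esub> else \<zero>\<^bsub>R\<^esub>)"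
proof -
  obtain A B where "\<forall>i\<in>I. \<forall>j\<in>J. A i j \<in> carrier R \<and> B j i \<in> carrier R"
    and "\<forall>i\<in>I. \<forall>k\<in>I.
      (\<Oplus>\<^bsub>R\<^esub>j\<in>J. A i j \<otimes>\<^bsub>R\<^esub> B j k) = (if i = k then \<one>\<^bsub>R\<^esub> else \<zero>\<^bsub>R\<^esub>)"
    using assms unfolding identity_factors_def by (elim exE conjE)
  then show thesis by (intro that[of A B]) blast+
qed

text \<open>Dropping rows of \<open>A\<close> and the matching columns of \<open>B\<close> leaves a
  smaller identity matrix, so an injection suffices on the outer index. The inner index is summed
  over and needs a bijection.\<close>

lemma (in ring) identity_factors_reindex:
  assumes "identity_factors R I J" and g: "inj_on g I'" "g ` I' \<subseteq> I" and h: "bij_betw h J' J"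
  shows "identity_factors R I' J'"
proof -
  obtain A B where A: "\<And>i j. i \<in> I \<Longrightarrow> j \<in> J \<Longrightarrow> A i j \<in> carrier R"
    and B: "\<And>i j. i \<in> I \<Longrightarrow> j \<in> J \<Longrightarrow> B j i \<in> carrier R"
    and AB: "\<And>i k. i \<in> I \<Longrightarrow> k \<in> I \<Longrightarrow> (\<Oplus>j\<in>J. A i j \<otimes> B j k) = (if i = k then \<one> else \<zero>)"
    using assms(1) by (rule identity_factorsE) (rule that)
  have gI: "g i \<in> I" if "i \<in> I'" for i using that g by auto
  have hJ: "h j \<in> J" if "j \<in> J'" for j using that h by (auto simp: bij_betw_def)
  have "(\<Oplus>j\<in>J'. A (g i) (h j) \<otimes> B (h j) (g k)) = (if i = k then \<one> else \<zero>)"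
    if "i \<in> I'" "k \<in> I'" for i k
  proof -
    have "(\<Oplus>j\<in>h ` J'. A (g i) j \<otimes> B j (g k)) = (\<Oplus>j\<in>J'. A (g i) (h j) \<otimes> B (h j) (g k))"
      using h hJ gI that A B by (intro finsum_reindex) (auto simp: bij_betw_def)
    moreover have "h ` J' = J" using h by (simp add: bij_betw_def)
    ultimately show ?thesis
      using AB[of "g i" "g k"] gI that g by (auto simp: inj_on_eq_iff)
  qed
  then show ?thesis
    unfolding identity_factors_def using A B gI hJ
    by - (rule exI[of _ "\<lambda>i j. A (g i) (h j)"],
        rule exI[of _ "\<lambda>j i. B (h j) (g i)"], auto)
qed

lemma (in ring_hom_ring) identity_factors_hom:
  assumes "identity_factors R I J"
  shows "identity_factors S I J"
proof -
  obtain A B where A: "\<And>i j. i \<in> I \<Longrightarrow> j \<in> J \<Longrightarrow> A i j \<in> carrier R"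
    and B: "\<And>i j. i \<in> I \<Longrightarrow> j \<in> J \<Longrightarrow> B j i \<in> carrier R"
    and AB: "\<And>i k. i \<in> I \<Longrightarrow> k \<in> I \<Longrightarrow> (\<Oplus>j\<in>J. A i j \<otimes> B j k) = (if i = k then \<one> else \<zero>)"
    using assms by (rule identity_factorsE) (rule that)
  have "(\<Oplus>\<^bsub>S\<^esub>j\<in>J. h (A i j) \<otimes>\<^bsub>S\<^esub> h (B j k)) = (if i = k then \<one>\<^bsub>S\<^esub> else \<zero>\<^bsub>S\<^esub>)"
    if "i \<in> I" "k \<in> I" for i k
  proof -
    have "(\<Oplus>\<^bsub>S\<^esub>j\<in>J. h (A i j) \<otimes>\<^bsub>S\<^esub> h (B j k)) = (\<Oplus>\<^bsub>S\<^esub>j\<in>J. h (A i j \<otimes> B j k))"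
      using that A B by (intro S.finsum_cong') auto
    also have "\<dots> = h (\<Oplus>j\<in>J. A i j \<otimes> B j k)"
      using that A B by (subst hom_finsum) (auto simp: o_def)
    finally show ?thesis using AB that by simp
  qed
  then show ?thesis
    unfolding identity_factors_def using A B
    by - (rule exI[of _ "\<lambda>i j. h (A i j)"],
        rule exI[of _ "\<lambda>j i. h (B j i)"], auto)
qed

section \<open>Epimorphisms of free right modules as matrix factorisations\<close>

definition unit_vec :: "('a, 'm) ring_scheme \<Rightarrow> nat \<Rightarrow> nat \<Rightarrow> nat \<Rightarrow> 'a"
  where "unit_vec R n j = (\<lambda>i\<in>{..<n}. if i = j then \<one>\<^bsub>R\<^esub> else \<zero>\<^bsub>R\<^esub>)"

context ring
begin

text \<open>For \<open>j\<close> outside the range this is the zero vector, so no bound on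
  \<open>j\<close> is required.\<close>

lemma unit_vec_closed [simp]: "unit_vec R n j \<in> free_vecs R n"
  by (auto simp: unit_vec_def free_vecs_def)

lemma free_vecs_nth [simp]: "v \<in> free_vecs R n \<Longrightarrow> i < n \<Longrightarrow> v i \<in> carrier R"
  by (auto simp: free_vecs_def)

text \<open>A right module map is left multiplication by the matrix whose columns are the images of
  the unit vectors, since \<open>v\<close> is the sum of the unit vectors scaled on the right by its
  entries.\<close>

lemma right_module_hom_matrix:
  assumes f: "f \<in> right_module_hom R n m" and v: "v \<in> free_vecs R n" and i: "i < m"
  shows "f v i = (\<Oplus>j\<in>{..<n}. f (unit_vec R n j) i \<otimes> v j)"
proof -
  have closed: "f w \<in> free_vecs R m" if "w \<in> free_vecs R n" for w
    using f that by (auto simp: right_module_hom_def)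
  have add: "f (vec_add R n w w') = vec_add R m (f w) (f w')"
    if "w \<in> free_vecs R n" "w' \<in> free_vecs R n" for w w'
    using f that by (auto simp: right_module_hom_def)
  have smult: "f (vec_rsmult R n w r) = vec_rsmult R m (f w) r"
    if "w \<in> free_vecs R n" "r \<in> carrier R" for w r
    using f that by (auto simp: right_module_hom_def)
  \<comment> \<open>The truncations \<open>t k\<close> build \<open>v\<close> one coordinate at a
    time, from the zero vector \<open>t 0\<close> to \<open>t n = v\<close>, which avoids finite
    sums of vectors.\<close>
  define t where "t k = (\<lambda>i\<in>{..<n}. if i < k then v i else \<zero>)" for k
  have t_closed: "t k \<in> free_vecs R n" for k
    using v by (auto simp: t_def free_vecs_def)
  have "f (t k) i = (\<Oplus>j\<in>{..<k}. f (unit_vec R n j) i \<otimes> v j)" if "k \<le> n" for k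
    using that
  proof (induction k)
    case 0
    \<comment> \<open>The zero vector is itself times zero, so \<open>f\<close> kills it by
      homogeneity.\<close>
    have "t 0 = vec_rsmult R n (t 0) \<zero>"
      by (auto simp: t_def vec_rsmult_def)
    then have "f (t 0) i = vec_rsmult R m (f (t 0)) \<zero> i"
      using smult[OF t_closed zero_closed, of 0] by simp
    also have "\<dots> = \<zero>"
      using free_vecs_nth[OF closed[OF t_closed] i] i by (simp add: vec_rsmult_def)
    finally show ?case by simp
  next
    case (Suc k)
    have vk: "v k \<in> carrier R" using v Suc.prems by simp
    have ek: "vec_rsmult R n (unit_vec R n k) (v k) \<in> free_vecs R n"
      using vk by (auto simp: vec_rsmult_def unit_vec_def free_vecs_def)
    have "t (Suc k) = vec_add R n (vec_rsmult R n (unit_vec R n k) (v k)) (t k)"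
      using v vk by (auto simp: t_def vec_add_def vec_rsmult_def unit_vec_def less_Suc_eq fun_eq_iff)
    then have "f (t (Suc k)) i = f (unit_vec R n k) i \<otimes> v k \<oplus> f (t k) i"
      using add[OF ek t_closed] smult[OF unit_vec_closed vk] i
      by (simp add: vec_add_def vec_rsmult_def)
    moreover have "f (unit_vec R n j) i \<otimes> v j \<in> carrier R" if "j < Suc k" for j
      using that Suc.prems free_vecs_nth[OF closed[OF unit_vec_closed] i] v by simp
    ultimately show ?case
      using Suc by (simp add: lessThan_Suc)
  qed
  moreover have "t n = v"
    using v by (auto simp: t_def free_vecs_def PiE_def extensional_def)
  ultimately show ?thesis by auto
qed

text \<open>Preimages of the unit vectors are the columns of a right inverse of the matrix of
  \<open>f\<close>.\<close>

lemma epi_imp_identity_factors: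
  assumes f: "f \<in> right_module_hom R n m" and surj: "f ` free_vecs R n = free_vecs R m"
  shows "identity_factors R {..<m} {..<n}"
proof -
  have "\<exists>w\<in>free_vecs R n. f w = unit_vec R m k" for k
    using surj unit_vec_closed[of m k] by (metis imageE)
  then obtain B where B: "\<And>k. B k \<in> free_vecs R n" "\<And>k. f (B k) = unit_vec R m k" by metis
  have closed: "f (unit_vec R n j) \<in> free_vecs R m" for j
    using surj by auto
  have "(\<Oplus>j\<in>{..<n}. f (unit_vec R n j) i \<otimes> B k j) = (if i = k then \<one> else \<zero>)" if "i < m" for i k
    using right_module_hom_matrix[OF f B(1) that, of k] that unfolding B(2)
    by (simp add: unit_vec_def)
  then show ?thesis
    unfolding identity_factors_def using free_vecs_nth[OF B(1)] free_vecs_nth[OF closed]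
    by - (rule exI[of _ "\<lambda>i j. f (unit_vec R n j) i"], rule exI[of _ "\<lambda>j k. B k j"], auto)
qed

text \<open>Left multiplication by \<open>A\<close> is onto because
  \<open>A (B w) = w\<close>.\<close>

lemma identity_factors_imp_epi:
  assumes "identity_factors R {..<m} {..<n}"
  shows "\<exists>f\<in>right_module_hom R n m. f ` free_vecs R n = free_vecs R m"
proof -
  obtain A B where A: "\<And>i j. i < m \<Longrightarrow> j < n \<Longrightarrow> A i j \<in> carrier R"
    and B: "\<And>i j. i < m \<Longrightarrow> j < n \<Longrightarrow> B j i \<in> carrier R"
    and AB: "\<And>i k. i < m \<Longrightarrow> k < m \<Longrightarrow>
      (\<Oplus>j\<in>{..<n}. A i j \<otimes> B j k) = (if i = k then \<one> else \<zero>)"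
    using assms by (rule identity_factorsE) auto
  define f where "f v = (\<lambda>i\<in>{..<m}. \<Oplus>j\<in>{..<n}. A i j \<otimes> v j)" for v
  have f_closed: "f v \<in> free_vecs R m" if "v \<in> free_vecs R n" for v
    using that A by (auto simp: f_def free_vecs_def intro!: finsum_closed)
  have "f (vec_add R n v w) = vec_add R m (f v) (f w)"
    if "v \<in> free_vecs R n" "w \<in> free_vecs R n" for v w
  proof -
    have "(\<Oplus>j\<in>{..<n}. A i j \<otimes> vec_add R n v w j) =
        (\<Oplus>j\<in>{..<n}. A i j \<otimes> v j) \<oplus> (\<Oplus>j\<in>{..<n}. A i j \<otimes> w j)" if "i < m" for i
    proof -
      have "(\<Oplus>j\<in>{..<n}. A i j \<otimes> vec_add R n v w j) =
          (\<Oplus>j\<in>{..<n}. A i j \<otimes> v j \<oplus> A i j \<otimes> w j)"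
        using that \<open>v \<in> _\<close> \<open>w \<in> _\<close> A by (intro finsum_cong') (auto simp: vec_add_def r_distr)
      then show ?thesis
        using that \<open>v \<in> _\<close> \<open>w \<in> _\<close> A by (simp add: finsum_addf Pi_def)
    qed
    then show ?thesis by (auto simp: f_def vec_add_def fun_eq_iff)
  qed
  moreover have "f (vec_rsmult R n v r) = vec_rsmult R m (f v) r"
    if "v \<in> free_vecs R n" "r \<in> carrier R" for v r
  proof -
    have "(\<Oplus>j\<in>{..<n}. A i j \<otimes> vec_rsmult R n v r j) = (\<Oplus>j\<in>{..<n}. A i j \<otimes> v j) \<otimes> r"
      if "i < m" for i
    proof -
      have "(\<Oplus>j\<in>{..<n}. A i j \<otimes> vec_rsmult R n v r j) = (\<Oplus>j\<in>{..<n}. A i j \<otimes> v j \<otimes> r)"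
        using that \<open>v \<in> _\<close> \<open>r \<in> _\<close> A by (intro finsum_cong') (auto simp: vec_rsmult_def m_assoc)
      then show ?thesis
        using that \<open>v \<in> _\<close> \<open>r \<in> _\<close> A by (simp add: finsum_ldistr Pi_def)
    qed
    then show ?thesis by (auto simp: f_def vec_rsmult_def fun_eq_iff)
  qed
  ultimately have f: "f \<in> right_module_hom R n m"
    using f_closed by (auto simp: right_module_hom_def)
  have "w \<in> f ` free_vecs R n" if w: "w \<in> free_vecs R m" for w
  proof
    define v where "v = (\<lambda>j\<in>{..<n}. \<Oplus>k\<in>{..<m}. B j k \<otimes> w k)"
    show v: "v \<in> free_vecs R n"
      using B w by (auto simp: v_def free_vecs_def intro!: finsum_closed)
    have "(\<Oplus>j\<in>{..<n}. A i j \<otimes> v j) = w i" if i: "i < m" for i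
    proof -
      have "(\<Oplus>j\<in>{..<n}. A i j \<otimes> v j) = (\<Oplus>j\<in>{..<n}. \<Oplus>k\<in>{..<m}. A i j \<otimes> B j k \<otimes> w k)"
      proof (intro finsum_cong')
        fix j assume "j \<in> {..<n}"
        then show "A i j \<otimes> v j = (\<Oplus>k\<in>{..<m}. A i j \<otimes> B j k \<otimes> w k)"
          using i A B w by (simp add: v_def finsum_rdistr Pi_def m_assoc cong: finsum_cong)
      qed (use i A B w in \<open>auto intro!: finsum_closed\<close>)
      also have "\<dots> = (\<Oplus>k\<in>{..<m}. \<Oplus>j\<in>{..<n}. A i j \<otimes> B j k \<otimes> w k)"
        using i A B w by (intro add.finprod_swap) auto
      also have "\<dots> = (\<Oplus>k\<in>{..<m}. (\<Oplus>j\<in>{..<n}. A i j \<otimes> B j k) \<otimes> w k)"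
        using i A B w by (intro finsum_cong') (auto simp: finsum_ldistr Pi_def intro!: finsum_closed)
      also have "\<dots> = (\<Oplus>k\<in>{..<m}. if i = k then w k else \<zero>)"
        using i AB w by (intro finsum_cong') auto
      also have "\<dots> = w i"
        using i w by (intro add.finprod_singleton) auto
      finally show ?thesis .
    qed
    then show "w = f v"
      using w by (auto simp: f_def free_vecs_def PiE_def extensional_def fun_eq_iff)
  qed
  then show ?thesis using f f_closed by blast
qed

lemma rank_condition_iff_identity_factors:
  "rank_condition R \<longleftrightarrow> (\<forall>n>0. \<not> identity_factors R {..<Suc n} {..<n})"
proof -
  have "(\<exists>f\<in>right_module_hom R n (Suc n). f ` free_vecs R n = free_vecs R (Suc n)) \<longleftrightarrow>
      identity_factors R {..<Suc n} {..<n}" for n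
    by (rule iffI, erule bexE, erule (1) epi_imp_identity_factors) (rule identity_factors_imp_epi)
  then show ?thesis
    by (simp only: rank_condition_def)
qed

text \<open>Keeping only \<open>card J + 1\<close> of the rows reduces to consecutive sizes.
  \<open>J\<close> must be nonempty because the rank condition speaks only of positive
  \<open>n\<close>.\<close>

lemma rank_condition_no_identity_factors:
  assumes "rank_condition R" "finite I" "finite J" "J \<noteq> {}" "card J < card I"
  shows "\<not> identity_factors R I J"
proof
  assume factors: "identity_factors R I J"
  obtain g where g: "bij_betw g {..<card I} I"
    using ex_bij_betw_nat_finite[OF assms(2)] by (auto simp: atLeast0LessThan)
  obtain h where h: "bij_betw h {..<card J} J"
    using ex_bij_betw_nat_finite[OF assms(3)] by (auto simp: atLeast0LessThan)
  have "{..<Suc (card J)} \<subseteq> {..<card I}" using assms(5) by auto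
  then have "inj_on g {..<Suc (card J)}" "g ` {..<Suc (card J)} \<subseteq> I"
    using g by (auto simp: bij_betw_def intro: inj_on_subset)
  then have "identity_factors R {..<Suc (card J)} {..<card J}"
    using identity_factors_reindex factors h by blast
  moreover have "card J > 0" using assms(3,4) by (simp add: card_gt_0_iff)
  ultimately show False
    using assms(1) by (simp add: rank_condition_iff_identity_factors)
qed

end

section \<open>Descent from the Ore extension to the coefficient ring\<close>

context ore_data
begin

text \<open>\<open>T\<close> is left multiplication by the variable, and each application raises the
  degree bound by one.\<close>

lemma bound_Tpow:
  assumes "bound \<zero> k p"
  shows "bound \<zero> (k + a) ((T ^^ a) p)"
proof (induction a)
  case 0
  then show ?case using assms by simp
next
  case (Suc a)
  then show ?case
    by (auto simp: bound_def ore_shift_def split: nat.split)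
qed

lemma Tpow_one: "(T ^^ a) \<one>\<^bsub>S\<^esub> = (\<lambda>c. if c = a then \<one> else \<zero>)"
proof (induction a)
  case 0
  show ?case by (simp add: one_ore)
next
  case (Suc a)
  have "T (\<lambda>c. if c = a then \<one> else \<zero>) = (\<lambda>c. if c = Suc a then \<one> else \<zero>)"
    by (auto simp: ore_shift_def fun_eq_iff split: nat.split)
  then show ?case using Suc.IH by simp
qed

lemma Tpow_finsum:
  assumes "finite J" "\<And>j. j \<in> J \<Longrightarrow> p j \<in> up R"
  shows "(T ^^ a) (\<Oplus>\<^bsub>S\<^esub>j\<in>J. p j) c = (\<Oplus>j\<in>J. (T ^^ a) (p j) c)"
proof -
  interpret S: ring S by (rule ore_extension_ring)
  show ?thesis
    using assms
  proof (induction J)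
    case empty
    then show ?case by (simp add: zero_ore Tpow_zero)
  next
    case (insert j J)
    have "(\<Oplus>\<^bsub>S\<^esub>j\<in>J. p j) \<in> up R"
      using S.finsum_closed[of p J] insert.prems by auto
    then show ?case
      using insert by (simp add: Pi_def add_ore Tpow_add up_Fn)
  qed
qed

text \<open>The excess \<open>k\<close> bounds the degrees of the entries of \<open>A\<close> and
  does not depend on \<open>d\<close>, so \<open>d\<close> can be chosen afterwards to suit
  \<open>k\<close>.\<close>

lemma identity_factors_truncate:
  assumes factors: "identity_factors S I J" and fin: "finite I" "finite J"
  obtains k :: nat where "\<And>d. identity_factors R (I \<times> {..d}) (J \<times> {..k + d})"
proof -
  obtain A B where A: "\<And>i j. i \<in> I \<Longrightarrow> j \<in> J \<Longrightarrow> A i j \<in> up R"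
    and B: "\<And>i j. i \<in> I \<Longrightarrow> j \<in> J \<Longrightarrow> B j i \<in> up R"
    and AB: "\<And>i i'. i \<in> I \<Longrightarrow> i' \<in> I \<Longrightarrow>
      (\<Oplus>\<^bsub>S\<^esub>j\<in>J. A i j \<otimes>\<^bsub>S\<^esub> B j i') = (if i = i' then \<one>\<^bsub>S\<^esub> else \<zero>\<^bsub>S\<^esub>)"
    using factors by (rule identity_factorsE) auto
  \<comment> \<open>Inserting 0 keeps the maximum meaningful when \<open>I\<close> or
    \<open>J\<close> is empty.\<close>
  define k where "k = Max (insert 0 ((\<lambda>(i, j). deg R (A i j)) ` (I \<times> J)))"
  have bound: "bound \<zero> k (A i j)" if "i \<in> I" "j \<in> J" for i j
  proof -
    have "deg R (A i j) \<le> k"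
      using that fin unfolding k_def by (intro Max_ge) auto
    then show ?thesis using bound_deg[OF A[OF that]] by (auto simp: bound_def)
  qed
  have "identity_factors R (I \<times> {..d}) (J \<times> {..k + d})" for d
    unfolding identity_factors_def
  \<comment> \<open>Row \<open>(i, a)\<close> of the first matrix lists the coefficients of
    \<open>x^a A i j\<close>; row \<open>(j, b)\<close> of the second lists those of
    \<open>x^b B j i\<close> up to degree \<open>d\<close>.\<close>
  proof (rule exI[of _ "\<lambda>(i, a) (j, b). (T ^^ a) (A i j) b"],
      rule exI[of _ "\<lambda>(j, b) (i, c). (T ^^ b) (B j i) c"], intro conjI ballI)
    let ?A = "\<lambda>(i, a) (j, b). (T ^^ a) (A i j) b"
    let ?B = "\<lambda>(j, b) (i, c). (T ^^ b) (B j i) c"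
    fix x assume x: "x \<in> I \<times> {..d}"
    show "?A x y \<in> carrier R" "?B y x \<in> carrier R" if "y \<in> J \<times> {..k + d}" for y
      using x that A B by (auto simp: up_Fn)
    fix z assume z: "z \<in> I \<times> {..d}"
    obtain i a i' c where xz: "x = (i, a)" "z = (i', c)" by fastforce
    have ia: "i \<in> I" "a \<le> d" "i' \<in> I" using x z xz by auto
    \<comment> \<open>As \<open>x^a A i j\<close> has degree at most
      \<open>k + a \<le> k + d\<close>, the sum over \<open>b\<close> omits no term of its product
      with \<open>B j i'\<close>.\<close>
    have row: "(\<Oplus>b\<in>{..k + d}. (T ^^ a) (A i j) b \<otimes> (T ^^ b) (B j i') c) =
        (T ^^ a) (A i j \<otimes>\<^bsub>S\<^esub> B j i') c" if "j \<in> J" for j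
    proof -
      have "bound \<zero> (k + d) ((T ^^ a) (A i j))"
        using bound_Tpow[OF bound[OF ia(1) that], of a] ia(2) by (auto simp: bound_def)
      then have "(T ^^ a) (A i j) \<otimes>\<^bsub>S\<^esub> B j i' = L (k + d) ((T ^^ a) (A i j)) (B j i')"
        using A B ia that by (intro mult_ore Tpow_up up_Fn)
      then show ?thesis
        using A B ia that by (simp add: mult_Tpow_left up_Fn L_def)
    qed
    have "(\<Oplus>y\<in>J \<times> {..k + d}. ?A x y \<otimes> ?B y z) =
        (\<Oplus>j\<in>J. \<Oplus>b\<in>{..k + d}. (T ^^ a) (A i j) b \<otimes> (T ^^ b) (B j i') c)"
      using fin A B ia xz by (subst R.add.finprod_cartesian_product) (auto simp: up_Fn)
    also have "\<dots> = (\<Oplus>j\<in>J. (T ^^ a) (A i j \<otimes>\<^bsub>S\<^esub> B j i') c)"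
      using row A B ia by (intro R.finsum_cong') (auto simp: mult_closed Tpow_up up_Fn)
    also have "\<dots> = (T ^^ a) (\<Oplus>\<^bsub>S\<^esub>j\<in>J. A i j \<otimes>\<^bsub>S\<^esub> B j i') c"
      using fin A B ia by (intro Tpow_finsum[symmetric]) (auto simp: mult_closed)
    \<comment> \<open>What remains is \<open>x^a\<close> times an entry of the identity matrix. Its
      coefficient at \<open>x^c\<close> is one exactly when \<open>i = i'\<close> and
      \<open>a = c\<close>.\<close>
    also have "\<dots> = (if x = z then \<one> else \<zero>)"
      using AB ia xz by (auto simp: Tpow_one zero_ore Tpow_zero)
    finally show "(\<Oplus>y\<in>J \<times> {..k + d}. ?A x y \<otimes> ?B y z) = (if x = z then \<one> else \<zero>)" .
  qed
  then show thesis by (rule that)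
qed

lemma rank_condition_ore_extension_iff: "rank_condition S \<longleftrightarrow> rank_condition R"
proof
  interpret S: ring S by (rule ore_extension_ring)
  interpret const: ring_hom_ring R S "\<lambda>a. monom S a 0"
    by (intro ring_hom_ring.intro ring_hom_ring_axioms.intro R.ring_axioms S.ring_axioms
        ore_extension_const_hom)
  \<comment> \<open>By contraposition: the embedding of constants carries a factorisation over
    \<open>R\<close> to one over \<open>S\<close>.\<close>
  show "rank_condition S \<Longrightarrow> rank_condition R"
    using const.identity_factors_hom
    by (auto simp: R.rank_condition_iff_identity_factors S.rank_condition_iff_identity_factors)
  assume R: "rank_condition R"
  show "rank_condition S"
    unfolding S.rank_condition_iff_identity_factors
  proof (intro allI impI notI)
    fix n :: nat
    assume n: "n > 0" and "identity_factors S {..<Suc n} {..<n}"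
    then obtain k :: nat where k:
      "\<And>d. identity_factors R ({..<Suc n} \<times> {..d}) ({..<n} \<times> {..k + d})"
      using identity_factors_truncate [OF _ finite_lessThan finite_lessThan] by blast
    \<comment> \<open>With \<open>d = n k\<close> the sizes are \<open>n (k + n k + 1)\<close> and
      \<open>(n + 1) (n k + 1)\<close>, which differ by exactly one.\<close>
    have "card ({..<n} \<times> {..k + n * k}) < card ({..<Suc n} \<times> {..n * k})"
      by (simp add: card_cartesian_product algebra_simps)
    moreover have "{..<n} \<times> {..k + n * k} \<noteq> {}" using n by auto
    ultimately show False
      using R.rank_condition_no_identity_factors[OF R,
          of "{..<Suc n} \<times> {..n * k}" "{..<n} \<times> {..k + n * k}"]
        k[of "n * k"] by (simp del: lessThan_Suc)
  qed
qed

end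

theorem theorem0p1:
  fixes R :: "('a, 'm) ring_scheme" and \<sigma> \<delta> :: "'a \<Rightarrow> 'a"
  assumes "ring R"
    and "\<sigma> \<in> ring_hom R R"
    and "sigma_derivation R \<sigma> \<delta>"
  shows "rank_condition (ore_extension R \<sigma> \<delta>) \<longleftrightarrow> rank_condition R"
proof -
  interpret ore_data R \<sigma> \<delta>
    using assms by (simp add: ore_data_def ore_data_axioms_def)
  show ?thesis by (rule rank_condition_ore_extension_iff)
qed

end
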